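(* Let $f:\Sigma\to\mathbb{R}^3$ be a front, $\nu$ a unit normal vector to $f$ and $p\in\Sigma$ a cuspidal edge. Then the focal surface $\widehat{FC}_f$ is regular (i.e. an immersion) at $p$. Moreover, the limiting tangent plane of $f$ at $f(p)$ and the tangent plane of $\widehat{FC}_f$ at $\widehat{FC}_f(p)$ intersect orthogonally.
   Context: Let $\Sigma\subset\mathbb{R}^2$ be a domain. A $C^\infty$ map $f:\Sigma\to\mathbb{R}^3$ is a (wave) front if there is a $C^\infty$ unit vector field $\nu:\Sigma\to S^2$ (the unit normal) with $\langle df_q(X),\nu(q)\rangle=0$ for all $q\in\Sigma$, $X\in T_q\Sigma$, such that $(f,\nu):\Sigma\to\mathbb{R}^3\times S^2$ is an immersion. $S(f)$ denotes the set of points where $f$ is not an immersion. A point $p$ is a cuspidal edge of $f$ if the germ of $f$ at $p$ coincides, up to diffeomorphism germs of source and target, with the germ of $(u,v)\mapsto(u,v^2,v^3)$ at $0$. Adapted coordinates. Near a cuspidal edge $p$, $S(f)$ is a regular curve consisting of cuspidal edges, and there is a coordinate system $(U;u,v)$ centered at $p$ with $S(f)\cap U=\{v=0\}$, $f_v(u,0)=0$ and $\lambda_v(u,0)>0$, where $\lambda=\det(f_u,f_v,\nu)$. Write $f_v=vh$ with $h:U\to\mathbb{R}^3\setminus\{0\}$ smooth, and set $\tilde E=|f_u|^2$, $\tilde F=\langle f_u,h\rangle$, $\tilde G=|h|^2$, $\tilde L=-\langle f_u,\nu_u\rangle$, $\tilde M=-\langle h,\nu_u\rangle$, $\tilde N=-\langle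 h,\nu_v\rangle$, $\tilde A=\tilde E\tilde N-2v\tilde F\tilde M+v\tilde G\tilde L$, $\tilde B=\sqrt{\tilde A^2-4v(\tilde E\tilde G-\tilde F^2)(\tilde L\tilde N-v\tilde M^2)}$. Here $\tilde N\neq0$ on the $u$-axis; let $\epsilon=\mathrm{sgn}\,\tilde N(p)$. After shrinking $U$, the two principal curvatures of $f$ at points with $v\ne0$ are the bounded one $\kappa=\frac{2(\tilde L\tilde N-v\tilde M^2)}{\tilde A+\epsilon\tilde B}$, which is $C^\infty$ on $U$, and the unbounded one $\kappa'=\frac{\tilde A+\epsilon\tilde B}{2v(\tilde E\tilde G-\tilde F^2)}$. Set $\hat\kappa=\lambda\kappa'$, which extends to a $C^\infty$ function $\hat\kappa=\frac{\tilde A+\epsilon\tilde B}{2|f_u\times h|}$ on $U$, nowhere zero near the $u$-axis. The focal surface corresponding to the unbounded principal curvature is $$\widehat{FC}_f=f+\frac{\lambda}{\hat\kappa}\nu,$$ a $C^\infty$ map near $p$ (independent of the choice of coordinates). The limiting tangent plane of $f$ at $f(p)$ is the plane through $f(p)$ perpendicular to $\nu(p)$. Note that $\widehat{FC}_f(p)=f(p)$. *)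

theory Defs
  imports "HOL-Analysis.Analysis"
begin

section \<open>Smooth maps, immersions, diffeomorphisms\<close>

text \<open>\<open>C\<^sup>k\<close> on a set, which is open in all uses below: all iterated directional derivatives up to
  order \<open>k\<close> exist in the Frechet sense and are continuous.\<close>

primrec higher_differentiable_on ::
  "'a::real_normed_vector set \<Rightarrow> ('a \<Rightarrow> 'b::real_normed_vector) \<Rightarrow> nat \<Rightarrow> bool" where
  "higher_differentiable_on S f 0 \<longleftrightarrow> continuous_on S f"
| "higher_differentiable_on S f (Suc k) \<longleftrightarrow>
     (\<forall>x\<in>S. f differentiable (at x)) \<and>
     (\<forall>w. higher_differentiable_on S (\<lambda>x. frechet_derivative f (at x) w) k)"

definition smooth_on :: "'a::real_normed_vector set \<Rightarrow> ('a \<Rightarrow> 'b::real_normed_vector) \<Rightarrow> bool" where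
  "smooth_on S f \<longleftrightarrow> (\<forall>k. higher_differentiable_on S f k)"

definition immersion_at :: "('a::real_normed_vector \<Rightarrow> 'b::real_normed_vector) \<Rightarrow> 'a \<Rightarrow> bool" where
  "immersion_at g p \<longleftrightarrow> g differentiable (at p) \<and> inj (frechet_derivative g (at p))"

definition smooth_diffeo ::
  "'a::real_normed_vector set \<Rightarrow> 'b::real_normed_vector set \<Rightarrow> ('a \<Rightarrow> 'b) \<Rightarrow> bool" where
  "smooth_diffeo V U \<phi> \<longleftrightarrow> open V \<and> open U \<and> bij_betw \<phi> V U \<and>
     smooth_on V \<phi> \<and> smooth_on U (the_inv_into V \<phi>)"

section \<open>Fronts and cuspidal edges\<close>

definition unit_normal_field :: "(real^2) set \<Rightarrow> (real^2 \<Rightarrow> real^3) \<Rightarrow> (real^2 \<Rightarrow> real^3) \<Rightarrow> bool" where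
  "unit_normal_field \<Sigma> f \<nu> \<longleftrightarrow> smooth_on \<Sigma> \<nu> \<and> (\<forall>q\<in>\<Sigma>. norm (\<nu> q) = 1) \<and>
     (\<forall>q\<in>\<Sigma>. \<forall>X. frechet_derivative f (at q) X \<bullet> \<nu> q = 0)"

definition front :: "(real^2) set \<Rightarrow> (real^2 \<Rightarrow> real^3) \<Rightarrow> bool" where
  "front \<Sigma> f \<longleftrightarrow> smooth_on \<Sigma> f \<and>
     (\<exists>\<nu>. unit_normal_field \<Sigma> f \<nu> \<and> (\<forall>q\<in>\<Sigma>. immersion_at (\<lambda>x. (f x, \<nu> x)) q))"

definition singular_set :: "(real^2) set \<Rightarrow> (real^2 \<Rightarrow> real^3) \<Rightarrow> (real^2) set" where
  "singular_set \<Sigma> f = {q \<in> \<Sigma>. \<not> immersion_at f q}"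

definition standard_cuspidal_edge :: "real^2 \<Rightarrow> real^3" where
  "standard_cuspidal_edge x = vector [x$1, (x$2)^2, (x$2)^3]"

definition cuspidal_edge :: "(real^2) set \<Rightarrow> (real^2 \<Rightarrow> real^3) \<Rightarrow> real^2 \<Rightarrow> bool" where
  "cuspidal_edge \<Sigma> f p \<longleftrightarrow>
     (\<exists>W U \<Omega> \<Omega>' \<psi> \<Phi>.
        smooth_diffeo W U \<psi> \<and> 0 \<in> W \<and> \<psi> 0 = p \<and> U \<subseteq> \<Sigma> \<and>
        smooth_diffeo \<Omega> \<Omega>' \<Phi> \<and> standard_cuspidal_edge ` W \<subseteq> \<Omega> \<and>
        (\<forall>x\<in>W. f (\<psi> x) = \<Phi> (standard_cuspidal_edge x)))"

section \<open>Adapted coordinates\<close>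

definition pd_u :: "(real^2 \<Rightarrow> 'b::real_normed_vector) \<Rightarrow> real^2 \<Rightarrow> 'b" where
  "pd_u g x = frechet_derivative g (at x) (axis 1 1)"

definition pd_v :: "(real^2 \<Rightarrow> 'b::real_normed_vector) \<Rightarrow> real^2 \<Rightarrow> 'b" where
  "pd_v g x = frechet_derivative g (at x) (axis 2 1)"

text \<open>From here on \<open>F\<close> and \<open>n\<close> stand for \<open>f\<close> and \<open>\<nu>\<close> expressed in coordinates.\<close>

definition area_density :: "(real^2 \<Rightarrow> real^3) \<Rightarrow> (real^2 \<Rightarrow> real^3) \<Rightarrow> real^2 \<Rightarrow> real" where
  "area_density F n x = det (vector [pd_u F x, pd_v F x, n x] :: real^3^3)"

text \<open>A coordinate system centered at \<open>p\<close> is given by its inverse, the parametrisation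
  \<open>\<phi> : V \<rightarrow> U\<close> with \<open>V\<close> in the \<open>(u,v)\<close>-plane and \<open>U\<close> in \<open>\<Sigma>\<close>; here \<open>u = x$1\<close> and \<open>v = x$2\<close>.\<close>

definition adapted_coordinates ::
  "(real^2) set \<Rightarrow> (real^2 \<Rightarrow> real^3) \<Rightarrow> (real^2 \<Rightarrow> real^3) \<Rightarrow> real^2 \<Rightarrow>
   (real^2) set \<Rightarrow> (real^2) set \<Rightarrow> (real^2 \<Rightarrow> real^2) \<Rightarrow> bool" where
  "adapted_coordinates \<Sigma> f \<nu> p V U \<phi> \<longleftrightarrow>
     smooth_diffeo V U \<phi> \<and> 0 \<in> V \<and> \<phi> 0 = p \<and> U \<subseteq> \<Sigma> \<and>
     singular_set \<Sigma> f \<inter> U = \<phi> ` {x \<in> V. x$2 = 0} \<and>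
     (\<forall>x\<in>V. x$2 = 0 \<longrightarrow> pd_v (f \<circ> \<phi>) x = 0) \<and>
     (\<forall>x\<in>V. x$2 = 0 \<longrightarrow> pd_v (area_density (f \<circ> \<phi>) (\<nu> \<circ> \<phi>)) x > 0)"

text \<open>The factor \<open>h\<close> in \<open>f\<^sub>v = v h\<close>.  It exists by Hadamard's lemma and, being continuous, is
  uniquely determined on \<open>V\<close>.\<close>

definition v_factor :: "(real^2) set \<Rightarrow> (real^2 \<Rightarrow> real^3) \<Rightarrow> (real^2 \<Rightarrow> real^3) \<Rightarrow> bool" where
  "v_factor V F h \<longleftrightarrow> smooth_on V h \<and> (\<forall>x\<in>V. h x \<noteq> 0) \<and> (\<forall>x\<in>V. pd_v F x = x$2 *\<^sub>R h x)"

section \<open>Modified fundamental forms and the unbounded principal curvature\<close>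

definition tE :: "(real^2 \<Rightarrow> real^3) \<Rightarrow> real^2 \<Rightarrow> real" where
  "tE F x = (norm (pd_u F x))\<^sup>2"

definition tF :: "(real^2 \<Rightarrow> real^3) \<Rightarrow> (real^2 \<Rightarrow> real^3) \<Rightarrow> real^2 \<Rightarrow> real" where
  "tF F h x = pd_u F x \<bullet> h x"

definition tG :: "(real^2 \<Rightarrow> real^3) \<Rightarrow> real^2 \<Rightarrow> real" where
  "tG h x = (norm (h x))\<^sup>2"

definition tL :: "(real^2 \<Rightarrow> real^3) \<Rightarrow> (real^2 \<Rightarrow> real^3) \<Rightarrow> real^2 \<Rightarrow> real" where
  "tL F n x = - (pd_u F x \<bullet> pd_u n x)"

definition tM :: "(real^2 \<Rightarrow> real^3) \<Rightarrow> (real^2 \<Rightarrow> real^3) \<Rightarrow> real^2 \<Rightarrow> real" where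
  "tM n h x = - (h x \<bullet> pd_u n x)"

definition tN :: "(real^2 \<Rightarrow> real^3) \<Rightarrow> (real^2 \<Rightarrow> real^3) \<Rightarrow> real^2 \<Rightarrow> real" where
  "tN n h x = - (h x \<bullet> pd_v n x)"

definition tA :: "(real^2 \<Rightarrow> real^3) \<Rightarrow> (real^2 \<Rightarrow> real^3) \<Rightarrow> (real^2 \<Rightarrow> real^3) \<Rightarrow> real^2 \<Rightarrow> real" where
  "tA F n h x = tE F x * tN n h x - 2 * x$2 * tF F h x * tM n h x + x$2 * tG h x * tL F n x"

definition tB :: "(real^2 \<Rightarrow> real^3) \<Rightarrow> (real^2 \<Rightarrow> real^3) \<Rightarrow> (real^2 \<Rightarrow> real^3) \<Rightarrow> real^2 \<Rightarrow> real" where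
  "tB F n h x = sqrt ((tA F n h x)\<^sup>2 -
     4 * x$2 * (tE F x * tG h x - (tF F h x)\<^sup>2) * (tL F n x * tN n h x - x$2 * (tM n h x)\<^sup>2))"

text \<open>The smooth extension of \<open>\<lambda> \<kappa>'\<close> across the \<open>u\<close>-axis, where
  \<open>\<kappa>' = (A + \<epsilon> B) / (2 v (E G - F\<^sup>2))\<close> is the unbounded principal curvature and
  \<open>\<lambda> = v * norm (cross3 f\<^sub>u h)\<close>, \<open>E G - F\<^sup>2 = (norm (cross3 f\<^sub>u h))\<^sup>2\<close>.  The sign
  \<open>\<epsilon>\<close> is that of \<open>N\<close> at the base point, which has coordinates \<open>0\<close>.\<close>

definition kappa_hat :: "(real^2 \<Rightarrow> real^3) \<Rightarrow> (real^2 \<Rightarrow> real^3) \<Rightarrow> (real^2 \<Rightarrow> real^3) \<Rightarrow> real^2 \<Rightarrow> real" where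
  "kappa_hat F n h x =
     (tA F n h x + sgn (tN n h 0) * tB F n h x) / (2 * norm (cross3 (pd_u F x) (h x)))"

section \<open>The focal surface and tangent planes\<close>

text \<open>The focal surface as a map on the coordinate neighbourhood \<open>\<phi> ` V\<close> in \<open>\<Sigma>\<close>; only its germ at
  \<open>p\<close> is meaningful.\<close>

definition focal_surface ::
  "(real^2 \<Rightarrow> real^3) \<Rightarrow> (real^2 \<Rightarrow> real^3) \<Rightarrow> (real^2) set \<Rightarrow> (real^2 \<Rightarrow> real^2) \<Rightarrow>
   (real^2 \<Rightarrow> real^3) \<Rightarrow> real^2 \<Rightarrow> real^3" where
  "focal_surface f \<nu> V \<phi> h q =
     (let x = the_inv_into V \<phi> q in
        f q + (area_density (f \<circ> \<phi>) (\<nu> \<circ> \<phi>) x / kappa_hat (f \<circ> \<phi>) (\<nu> \<circ> \<phi>) h x) *\<^sub>R \<nu> q)"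

definition limiting_tangent_plane ::
  "(real^2 \<Rightarrow> real^3) \<Rightarrow> (real^2 \<Rightarrow> real^3) \<Rightarrow> real^2 \<Rightarrow> (real^3) set" where
  "limiting_tangent_plane f \<nu> p = {y. (y - f p) \<bullet> \<nu> p = 0}"

definition tangent_plane_at :: "(real^2 \<Rightarrow> real^3) \<Rightarrow> real^2 \<Rightarrow> (real^3) set" where
  "tangent_plane_at g p = {g p + frechet_derivative g (at p) X | X. True}"

definition planes_intersect_orthogonally :: "(real^3) set \<Rightarrow> (real^3) set \<Rightarrow> bool" where
  "planes_intersect_orthogonally P Q \<longleftrightarrow>
     (\<exists>c a b. a \<noteq> 0 \<and> b \<noteq> 0 \<and> orthogonal a b \<and>
        P = {y. (y - c) \<bullet> a = 0} \<and> Q = {y. (y - c) \<bullet> b = 0})"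

end

theory Submission
  imports Defs
begin

text \<open>Work in adapted coordinates with \<open>F = f \<circ> \<phi>\<close>, \<open>n = \<nu> \<circ> \<phi>\<close> and \<open>F\<^sub>v = v h\<close>.  The density
  \<open>\<lambda> = v \<langle>F\<^sub>u, h \<times> n\<rangle>\<close> vanishes on the \<open>u\<close>-axis, and so does \<open>F\<^sub>v\<close>.  Hence the focal surface
  \<open>F + (\<lambda> / \<kappa>) n\<close>, where \<open>\<kappa>\<close> is the extension of \<open>\<lambda> \<kappa>'\<close>, has at the base point the derivative
  \<open>(k\<^sub>1, k\<^sub>2) \<mapsto> k\<^sub>1 F\<^sub>u + k\<^sub>2 c n\<close> with \<open>c = \<langle>F\<^sub>u, h \<times> n\<rangle> / \<kappa>\<close>.  As \<open>F\<^sub>u\<close> and \<open>n\<close> are nonzero and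
  orthogonal, this is injective as soon as \<open>c \<noteq> 0\<close>; its image then contains \<open>n\<close>, the normal
  of the limiting tangent plane, and this is the claimed orthogonality.  Only the continuity of
  \<open>\<kappa>\<close> enters, because it is multiplied by a function that vanishes at the base point
  (\<open>focal_surface_has_derivative\<close>).

  The numerator of \<open>c\<close> is \<open>\<lambda>\<^sub>v > 0\<close> (\<open>pd_v_area_density\<close>), and there \<open>\<kappa>\<close> equals
  \<open>|F\<^sub>u|\<^sup>2 N / |F\<^sub>u \<times> h|\<close> with \<open>N = - \<langle>h, n\<^sub>v\<rangle>\<close> (\<open>kappa_hat_origin\<close>).  What remains is
  \<open>N \<noteq> 0\<close>, and here the front property is used.  Since \<open>F\<^sub>v = 0\<close>, the immersion \<open>(f, n)\<close> forces
  \<open>n\<^sub>v \<noteq> 0\<close>.  This vector is orthogonal to \<open>n\<close>, and also to \<open>F\<^sub>u\<close>, because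
  \<open>\<langle>F\<^sub>u, n\<^sub>v\<rangle> = - \<langle>F\<^sub>u\<^sub>v, n\<rangle>\<close> and \<open>F\<^sub>u\<^sub>v = (v h)\<^sub>u = 0\<close> on the axis; so it cannot be orthogonal to
  \<open>h\<close> as well, \<open>F\<^sub>u\<close>, \<open>h\<close>, \<open>n\<close> being a basis.  The normal that makes \<open>f\<close> a front need not be the
  given \<open>\<nu>\<close>, but the two agree up to sign at the base point, and \<open>N = \<langle>h\<^sub>v, n\<rangle>\<close> depends on the
  normal at that point only (\<open>v_factor_pd_v_normal_nonzero\<close>).\<close>

unbundle cross3_syntax

section \<open>Derivatives, mean value bounds and products\<close>

lemma smooth_on_continuous: "smooth_on S f \<Longrightarrow> continuous_on S f"
  unfolding smooth_on_def by (auto dest: spec[of _ 0])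

lemma smooth_on_differentiable: "smooth_on S f \<Longrightarrow> x \<in> S \<Longrightarrow> f differentiable (at x)"
  unfolding smooth_on_def by (auto dest: spec[of _ "Suc 0"])

lemma smooth_on_continuous_derivative:
  "smooth_on S f \<Longrightarrow> continuous_on S (\<lambda>x. frechet_derivative f (at x) w)"
  unfolding smooth_on_def by (auto dest: spec[of _ "Suc 0"])

lemma has_frechet_derivative:
  "f differentiable (at x) \<Longrightarrow> (f has_derivative frechet_derivative f (at x)) (at x)"
  by (simp add: frechet_derivative_works)

text \<open>By the chain rule the derivative of \<open>g\<close> is taken at a point and in a direction that both vary.
  Smoothness controls it for fixed directions only, so the moving direction is expanded in a basis.\<close>

lemma continuous_on_derivative_compose:
  fixes g :: "'b::euclidean_space \<Rightarrow> 'c::real_normed_vector"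
  assumes g: "smooth_on S g" and \<phi>: "smooth_on V \<phi>" and sub: "\<phi> ` V \<subseteq> S"
  shows "continuous_on V (\<lambda>x. frechet_derivative (g \<circ> \<phi>) (at x) w)"
proof -
  have "frechet_derivative (g \<circ> \<phi>) (at x) w =
      (\<Sum>b\<in>Basis. (frechet_derivative \<phi> (at x) w \<bullet> b) *\<^sub>R frechet_derivative g (at (\<phi> x)) b)"
    if x: "x \<in> V" for x
  proof -
    have d: "\<phi> differentiable (at x)" "g differentiable (at (\<phi> x))"
      using x sub smooth_on_differentiable[OF \<phi>] smooth_on_differentiable[OF g] by auto
    interpret linear "frechet_derivative g (at (\<phi> x))"
      by (rule linear_frechet_derivative[OF d(2)])
    let ?w = "frechet_derivative \<phi> (at x) w"
    have "frechet_derivative (g \<circ> \<phi>) (at x) w = frechet_derivative g (at (\<phi> x)) ?w"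
      by (simp add: frechet_derivative_compose[OF d])
    also have "\<dots> = frechet_derivative g (at (\<phi> x)) (\<Sum>b\<in>Basis. (?w \<bullet> b) *\<^sub>R b)"
      by (simp only: euclidean_representation)
    also have "\<dots> = (\<Sum>b\<in>Basis. (?w \<bullet> b) *\<^sub>R frechet_derivative g (at (\<phi> x)) b)"
      by (simp add: sum scale)
    finally show ?thesis .
  qed
  moreover have "continuous_on V (\<lambda>x. \<Sum>b\<in>Basis.
      (frechet_derivative \<phi> (at x) w \<bullet> b) *\<^sub>R frechet_derivative g (at (\<phi> x)) b)"
    by (intro continuous_intros smooth_on_continuous_derivative[OF \<phi>]
        continuous_on_compose2[OF smooth_on_continuous_derivative[OF g] smooth_on_continuous[OF \<phi>] sub])
  ultimately show ?thesis by (simp cong: continuous_on_cong)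
qed

lemma linear_real2:
  fixes L :: "real^2 \<Rightarrow> 'b::real_vector"
  assumes "linear L"
  shows "L k = k$1 *\<^sub>R L (axis 1 1) + k$2 *\<^sub>R L (axis 2 1)"
proof -
  have "k = k$1 *\<^sub>R axis 1 1 + k$2 *\<^sub>R axis 2 1"
    by (simp add: vec_eq_iff forall_2 axis_def)
  then have "L k = L (k$1 *\<^sub>R axis 1 1 + k$2 *\<^sub>R axis 2 1)"
    by (rule arg_cong)
  also have "\<dots> = k$1 *\<^sub>R L (axis 1 1) + k$2 *\<^sub>R L (axis 2 1)"
    by (simp only: linear_add[OF assms] linear_scale[OF assms])
  finally show ?thesis .
qed

lemma has_vector_derivative_along_line:
  assumes "g differentiable (at (a + t *\<^sub>R w))"
  shows "((\<lambda>s. g (a + s *\<^sub>R w)) has_vector_derivative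
           frechet_derivative g (at (a + t *\<^sub>R w)) w) (at t)"
proof -
  have "((\<lambda>s. a + s *\<^sub>R w) has_derivative (\<lambda>s. s *\<^sub>R w)) (at t)"
    by (auto intro!: derivative_eq_intros)
  from diff_chain_at[OF this has_frechet_derivative[OF assms]]
  show ?thesis
    using linear_scale[OF linear_frechet_derivative[OF assms]]
    by (simp add: has_vector_derivative_def o_def)
qed

lemma vector_mean_value_bound:
  fixes g :: "real \<Rightarrow> 'b::real_normed_vector"
  assumes d: "\<And>t. t \<in> closed_segment a b \<Longrightarrow> (g has_vector_derivative g' t) (at t)"
    and B: "\<And>t. t \<in> closed_segment a b \<Longrightarrow> norm (g' t) \<le> B"
  shows "norm (g b - g a) \<le> B * \<bar>b - a\<bar>"
proof -
  have "norm (g b - g a) \<le> B * norm (b - a)"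
  proof (rule differentiable_bound[where S = "closed_segment a b" and f' = "\<lambda>t s. s *\<^sub>R g' t"])
    fix t assume t: "t \<in> closed_segment a b"
    show "(g has_derivative (\<lambda>s. s *\<^sub>R g' t)) (at t within closed_segment a b)"
      using d[OF t] has_derivative_at_withinI unfolding has_vector_derivative_def by blast
    show "onorm (\<lambda>s. s *\<^sub>R g' t) \<le> B"
      using B[OF t] by (intro onorm_le) (simp add: mult.commute[of B] mult_left_mono)
  qed auto
  then show ?thesis by simp
qed

text \<open>A bound on first-order increments passes to the derivative.  It is the device by which second-order
  information is extracted below without differentiating twice.\<close>

lemma norm_derivative_le_increment:
  fixes g :: "real \<Rightarrow> 'b::real_normed_vector"
  assumes d: "(g has_vector_derivative d) (at a)"
    and "\<forall>\<^sub>F t in at a. norm (g t - g a) \<le> c * \<bar>t - a\<bar>"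
  shows "norm d \<le> c"
proof -
  let ?r = "\<lambda>t. norm ((g t - g a) - (t - a) *\<^sub>R d) / norm (t - a)"
  have "?r \<midarrow>a\<rightarrow> 0"
    using d by (simp add: has_vector_derivative_def has_derivative_iff_norm)
  then have "(\<lambda>t. c + ?r t) \<midarrow>a\<rightarrow> c"
    using tendsto_add[OF tendsto_const[of c], of ?r 0 "at a"] by simp
  moreover have "\<forall>\<^sub>F t in at a. norm d \<le> c + ?r t"
    using assms(2) eventually_neq_at_within[of a a UNIV]
  proof eventually_elim
    case (elim t)
    have "\<bar>t - a\<bar> * norm d \<le> norm (g t - g a) + norm ((g t - g a) - (t - a) *\<^sub>R d)"
      using norm_triangle_ineq4[of "g t - g a" "(g t - g a) - (t - a) *\<^sub>R d"] by simp
    also have "\<dots> \<le> c * \<bar>t - a\<bar> + norm ((g t - g a) - (t - a) *\<^sub>R d)"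
      using elim by simp
    also have "\<dots> = \<bar>t - a\<bar> * (c + ?r t)"
      using elim by (simp add: distrib_left mult.commute)
    finally show ?case using elim(2) by (simp add: mult_le_cancel_left)
  qed
  ultimately show ?thesis
    by (rule tendsto_lowerbound) simp
qed

text \<open>In the product rule the derivative of \<open>m\<close> is multiplied by \<open>a x = 0\<close>; accordingly \<open>m\<close> need not be
  differentiable: \<open>a y (m y - m x)\<close> is \<open>O(|y - x|)\<close> times \<open>o(1)\<close>.\<close>

lemma has_derivative_scaleR_vanishing:
  fixes m :: "'a::real_normed_vector \<Rightarrow> 'b::real_normed_vector"
  assumes a: "(a has_derivative a') (at x)" and a0: "a x = 0" and m: "isCont m x"
  shows "((\<lambda>y. a y *\<^sub>R m y) has_derivative (\<lambda>k. a' k *\<^sub>R m x)) (at x)"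
proof -
  have "((\<lambda>y. a y *\<^sub>R m x) has_derivative (\<lambda>k. a' k *\<^sub>R m x)) (at x)"
    using a by (auto intro!: derivative_eq_intros)
  moreover have "((\<lambda>y. a y *\<^sub>R (m y - m x)) has_derivative (\<lambda>k. 0)) (at x)"
  proof -
    let ?r = "\<lambda>y. norm ((a y - a x) - a' (y - x)) / norm (y - x)"
    have bl: "bounded_linear a'" and "?r \<midarrow>x\<rightarrow> 0"
      using a by (simp_all add: has_derivative_iff_norm)
    moreover have "(\<lambda>y. norm (m y - m x)) \<midarrow>x\<rightarrow> 0"
      using m by (simp add: isCont_def LIM_zero_iff tendsto_norm_zero_iff)
    ultimately have U: "(\<lambda>y. (?r y + onorm a') * norm (m y - m x)) \<midarrow>x\<rightarrow> 0"
      using tendsto_mult[OF tendsto_add[OF _ tendsto_const[of "onorm a'"]], of ?r 0 "at x"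
          "\<lambda>y. norm (m y - m x)" 0] by simp
    have "norm (a y *\<^sub>R (m y - m x)) / norm (y - x) \<le> (?r y + onorm a') * norm (m y - m x)"
      if "y \<noteq> x" for y
    proof -
      have "norm (a y) \<le> norm ((a y - a x) - a' (y - x)) + norm (a' (y - x))"
        using norm_triangle_ineq[of "(a y - a x) - a' (y - x)" "a' (y - x)"] a0 by simp
      also have "\<dots> \<le> norm ((a y - a x) - a' (y - x)) + onorm a' * norm (y - x)"
        using onorm[OF bl] by simp
      finally have "norm (a y) / norm (y - x) \<le> ?r y + onorm a'"
        using that by (simp add: field_simps)
      from mult_right_mono[OF this, of "norm (m y - m x)"] show ?thesis by simp
    qed
    then have "(\<lambda>y. norm (a y *\<^sub>R (m y - m x)) / norm (y - x)) \<midarrow>x\<rightarrow> 0"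
      by (intro tendsto_sandwich[OF _ _ tendsto_const U])
        (auto simp: eventually_at_filter intro!: always_eventually)
    then show ?thesis
      using a0 by (simp add: has_derivative_iff_norm)
  qed
  ultimately have "((\<lambda>y. a y *\<^sub>R m x + a y *\<^sub>R (m y - m x)) has_derivative (\<lambda>k. a' k *\<^sub>R m x + 0)) (at x)"
    by (rule has_derivative_add)
  then show ?thesis
    by (simp add: scaleR_diff_right)
qed

section \<open>Normals and planes in three-space\<close>

lemma orthogonal_imp_multiple_cross3:
  assumes "w \<bullet> x = 0" "w \<bullet> y = 0" "x \<times> y \<noteq> 0"
  obtains r where "w = r *\<^sub>R (x \<times> y)"
proof -
  have "w \<times> (x \<times> y) = 0"
    using assms by (simp add: Lagrange)
  then have "collinear {0, x \<times> y, w}"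
    by (simp add: cross_eq_0 insert_commute)
  then show ?thesis using that assms(3)
    by (auto simp: collinear_lemma)
qed

lemma unit_normal_unique_up_to_sign:
  assumes "w \<bullet> x = 0" "w \<bullet> y = 0" "z \<bullet> x = 0" "z \<bullet> y = 0" "x \<times> y \<noteq> 0"
    and "norm w = 1" "norm z = 1"
  shows "w = z \<or> w = - z"
proof -
  obtain r s where rs: "w = r *\<^sub>R (x \<times> y)" "z = s *\<^sub>R (x \<times> y)"
    using assms orthogonal_imp_multiple_cross3 by metis
  then have "\<bar>r\<bar> * norm (x \<times> y) = \<bar>s\<bar> * norm (x \<times> y)" using assms by simp
  then have "\<bar>r\<bar> = \<bar>s\<bar>" using assms by simp
  then show ?thesis using rs by (auto simp: abs_eq_iff)
qed

lemma orthogonal_frame_imp_zero: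
  assumes "w \<bullet> x = 0" "w \<bullet> y = 0" "w \<bullet> z = 0" "z \<bullet> x = 0" "z \<bullet> y = 0" "x \<times> y \<noteq> 0" "z \<noteq> 0"
  shows "w = 0"
proof -
  obtain r s where "w = r *\<^sub>R (x \<times> y)" "z = s *\<^sub>R (x \<times> y)"
    using assms orthogonal_imp_multiple_cross3 by metis
  then show ?thesis using assms by auto
qed

lemma cross3_orthogonal_nonzero:
  assumes "x \<bullet> z = 0" "x \<noteq> 0" "z \<noteq> 0"
  shows "x \<times> z \<noteq> 0"
  using norm_cross_dot[of x z] assms by auto

text \<open>Subtracting from \<open>y - c\<close> its projections to \<open>x\<close> and \<open>z\<close> leaves a vector that is orthogonal to the
  whole frame \<open>x\<close>, \<open>z\<close>, \<open>x \<times> z\<close>.\<close>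

lemma plane_spanned_by_orthogonal:
  fixes c x z :: "real^3"
  assumes "x \<bullet> z = 0" "x \<noteq> 0" "z \<noteq> 0"
  shows "range (\<lambda>(r, s). c + (r *\<^sub>R x + s *\<^sub>R z)) = {y. (y - c) \<bullet> (x \<times> z) = 0}" (is "?A = ?B")
proof
  show "?A \<subseteq> ?B" by (auto simp: inner_add_left dot_cross_self)
  show "?B \<subseteq> ?A"
  proof
    fix y assume "y \<in> ?B"
    then have y: "(y - c) \<bullet> (x \<times> z) = 0" by simp
    define r where "r = (y - c) \<bullet> x / (x \<bullet> x)"
    define s where "s = (y - c) \<bullet> z / (z \<bullet> z)"
    let ?w = "(y - c) - (r *\<^sub>R x + s *\<^sub>R z)"
    have "?w = 0"
    proof (rule orthogonal_frame_imp_zero[of _ x z "x \<times> z"])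
      show "?w \<bullet> x = 0" "?w \<bullet> z = 0"
        using assms by (simp_all add: r_def s_def inner_diff_left inner_add_left inner_commute[of z x])
      show "?w \<bullet> (x \<times> z) = 0"
        using y by (simp add: inner_diff_left inner_add_left dot_cross_self)
      show "x \<times> z \<noteq> 0" "x \<times> z \<noteq> 0"
        by (rule cross3_orthogonal_nonzero[OF assms])+
      show "x \<times> z \<bullet> x = 0" "x \<times> z \<bullet> z = 0"
        by (metis dot_cross_self(1) inner_commute) (rule dot_cross_self(3))
    qed
    then have "y = c + (r *\<^sub>R x + s *\<^sub>R z)" by (simp add: right_minus_eq diff_eq_eq add.commute)
    then show "y \<in> ?A" by (auto simp: image_iff)
  qed
qed

section \<open>Unit normals along the u-axis\<close>

text \<open>Off the axis \<open>h = F\<^sub>v / v\<close>; a point of the axis is approached along its \<open>v\<close>-line.\<close>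

lemma v_factor_orthogonal_normal:
  fixes F n h :: "real^2 \<Rightarrow> real^3"
  assumes V: "open V" and h: "v_factor V F h" and n: "continuous_on V n"
    and Fn: "\<And>x. x \<in> V \<Longrightarrow> pd_v F x \<bullet> n x = 0" and a: "a \<in> V"
  shows "h a \<bullet> n a = 0"
proof (cases "a$2 = 0")
  case False
  then show ?thesis using h Fn[OF a] a by (simp add: v_factor_def)
next
  case True
  define c where "c = (\<lambda>t. a + t *\<^sub>R (axis 2 1 :: real^2))"
  have c0: "c 0 = a" and cv: "\<And>t. (c t)$2 = t"
    using True by (simp_all add: c_def axis_def)
  have cc: "isCont c 0" unfolding c_def by (intro continuous_intros)
  have "continuous_on V (\<lambda>x. h x \<bullet> n x)"
    using h n by (intro continuous_intros) (auto simp: v_factor_def smooth_on_continuous)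
  then have "isCont (\<lambda>x. h x \<bullet> n x) (c 0)"
    using V a by (simp add: c0 continuous_on_eq_continuous_at)
  with cc have "isCont (\<lambda>t. h (c t) \<bullet> n (c t)) 0"
    by (rule isCont_o2)
  then have lim: "(\<lambda>t. h (c t) \<bullet> n (c t)) \<midarrow>0\<rightarrow> h a \<bullet> n a"
    by (simp add: isCont_def c0)
  have "\<forall>\<^sub>F t in at 0. c t \<in> V"
    using cc V a by (intro topological_tendstoD) (auto simp: isCont_def c0)
  then have "\<forall>\<^sub>F t in at 0. h (c t) \<bullet> n (c t) = 0"
    using eventually_neq_at_within[of "0::real" 0 UNIV]
  proof eventually_elim
    case (elim t)
    then show ?case using Fn[of "c t"] h by (simp add: v_factor_def cv)
  qed
  then have "(\<lambda>t. h (c t) \<bullet> n (c t)) \<midarrow>0\<rightarrow> 0"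
    by (rule tendsto_eventually)
  with lim show ?thesis
    by (intro tendsto_unique[of "at 0" "\<lambda>t. h (c t) \<bullet> n (c t)"]) auto
qed

text \<open>This is the quantitative form of \<open>F\<^sub>u\<^sub>v = 0\<close> on the axis.  The mixed second difference of \<open>F\<close> over
  a rectangle with sides \<open>s\<close> and \<open>t\<close> is an increment in \<open>t\<close> of a function with derivative
  \<open>t (h(u + s, t) - h(u, t)) = O(|t| |s|)\<close>, hence \<open>O(t\<^sup>2 |s|)\<close>; dividing by \<open>s\<close> gives the bound.  This
  route replaces the symmetry of second derivatives.\<close>

lemma pd_u_increment_quadratic:
  fixes F h :: "real^2 \<Rightarrow> real^3"
  assumes V: "open V" and h: "v_factor V F h"
    and F: "\<And>x. x \<in> V \<Longrightarrow> F differentiable (at x)"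
    and a: "a \<in> V" "a$2 = 0"
  obtains K \<delta> where "K \<ge> 0" "\<delta> > 0"
    "\<And>t. \<bar>t\<bar> \<le> \<delta> \<Longrightarrow> norm (pd_u F (a + t *\<^sub>R axis 2 1) - pd_u F a) \<le> K * t\<^sup>2"
proof -
  let ?e1 = "axis 1 1 :: real^2" and ?e2 = "axis 2 1 :: real^2"
  obtain r where r: "r > 0" "cball a r \<subseteq> V"
    using V a open_contains_cball by blast
  have hs: "smooth_on V h" using h by (simp add: v_factor_def)
  have "compact (pd_u h ` cball a r)"
    using continuous_on_subset[OF smooth_on_continuous_derivative[OF hs] r(2), of "axis 1 1"]
    by (intro compact_continuous_image) (simp_all add: pd_u_def[abs_def])
  then have "\<exists>K. \<forall>x\<in>cball a r. norm (pd_u h x) \<le> K"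
    by (auto dest!: compact_imp_bounded simp: bounded_iff)
  then obtain K where K: "\<And>x. x \<in> cball a r \<Longrightarrow> norm (pd_u h x) \<le> K"
    by blast
  have K0: "K \<ge> 0" using order_trans[OF norm_ge_zero K[of a]] r(1) by simp
  have box: "a + t *\<^sub>R ?e2 + s *\<^sub>R ?e1 \<in> cball a r" if "\<bar>s\<bar> \<le> r/2" "\<bar>t\<bar> \<le> r/2" for s t
  proof -
    have "dist a (a + t *\<^sub>R ?e2 + s *\<^sub>R ?e1) = norm (t *\<^sub>R ?e2 + s *\<^sub>R ?e1)"
      by (subst dist_commute) (simp add: dist_norm add.assoc)
    also have "\<dots> \<le> \<bar>t\<bar> + \<bar>s\<bar>"
      using norm_triangle_ineq[of "t *\<^sub>R ?e2" "s *\<^sub>R ?e1"] by (simp add: norm_axis_1)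
    finally show ?thesis using that by simp
  qed
  have seg: "\<bar>\<tau>\<bar> \<le> \<bar>t\<bar>" if "\<tau> \<in> closed_segment 0 t" for \<tau> t :: real
    using that by (auto simp: closed_segment_eq_real_ivl split: if_splits)
  have h_step: "norm (h (a + t *\<^sub>R ?e2 + s *\<^sub>R ?e1) - h (a + t *\<^sub>R ?e2)) \<le> K * \<bar>s\<bar>"
    if st: "\<bar>s\<bar> \<le> r/2" "\<bar>t\<bar> \<le> r/2" for s t
  proof -
    have "norm (h (a + t *\<^sub>R ?e2 + s *\<^sub>R ?e1) - h (a + t *\<^sub>R ?e2 + 0 *\<^sub>R ?e1)) \<le> K * \<bar>s - 0\<bar>"
    proof (rule vector_mean_value_bound)
      fix \<sigma> assume "\<sigma> \<in> closed_segment 0 s"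
      then have \<sigma>: "a + t *\<^sub>R ?e2 + \<sigma> *\<^sub>R ?e1 \<in> cball a r"
        using seg[of \<sigma> s] st by (intro box) auto
      then show "((\<lambda>s. h (a + t *\<^sub>R ?e2 + s *\<^sub>R ?e1)) has_vector_derivative
          pd_u h (a + t *\<^sub>R ?e2 + \<sigma> *\<^sub>R ?e1)) (at \<sigma>)"
        unfolding pd_u_def using r(2)
        by (intro has_vector_derivative_along_line smooth_on_differentiable[OF hs]) auto
      show "norm (pd_u h (a + t *\<^sub>R ?e2 + \<sigma> *\<^sub>R ?e1)) \<le> K" by (rule K[OF \<sigma>])
    qed
    then show ?thesis by simp
  qed
  have F_step: "norm ((F (a + t *\<^sub>R ?e2 + s *\<^sub>R ?e1) - F (a + t *\<^sub>R ?e2)) - (F (a + s *\<^sub>R ?e1) - F a))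
      \<le> K * t\<^sup>2 * \<bar>s\<bar>" if st: "\<bar>s\<bar> \<le> r/2" "\<bar>t\<bar> \<le> r/2" for s t
  proof -
    let ?g = "\<lambda>\<tau>. F (a + s *\<^sub>R ?e1 + \<tau> *\<^sub>R ?e2) - F (a + \<tau> *\<^sub>R ?e2)"
    let ?g' = "\<lambda>\<tau>. pd_v F (a + s *\<^sub>R ?e1 + \<tau> *\<^sub>R ?e2) - pd_v F (a + \<tau> *\<^sub>R ?e2)"
    have "norm (?g t - ?g 0) \<le> (\<bar>t\<bar> * (K * \<bar>s\<bar>)) * \<bar>t - 0\<bar>"
    proof (rule vector_mean_value_bound[where g' = ?g'])
      fix \<tau> assume "\<tau> \<in> closed_segment 0 t"
      then have \<tau>: "\<bar>\<tau>\<bar> \<le> \<bar>t\<bar>" by (rule seg)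
      have mem: "a + s *\<^sub>R ?e1 + \<tau> *\<^sub>R ?e2 \<in> V" "a + \<tau> *\<^sub>R ?e2 \<in> V"
        using box[of s \<tau>] box[of 0 \<tau>] st \<tau> r by (auto simp: ac_simps)
      show "(?g has_vector_derivative ?g' \<tau>) (at \<tau>)"
        unfolding pd_v_def
        by (intro has_vector_derivative_diff has_vector_derivative_along_line F mem)
      have "?g' \<tau> = \<tau> *\<^sub>R (h (a + \<tau> *\<^sub>R ?e2 + s *\<^sub>R ?e1) - h (a + \<tau> *\<^sub>R ?e2))"
        using h mem a(2) by (simp add: v_factor_def axis_def scaleR_diff_right ac_simps)
      then have "norm (?g' \<tau>) = \<bar>\<tau>\<bar> * norm (h (a + \<tau> *\<^sub>R ?e2 + s *\<^sub>R ?e1) - h (a + \<tau> *\<^sub>R ?e2))"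
        by simp
      also have "\<dots> \<le> \<bar>t\<bar> * (K * \<bar>s\<bar>)"
        using h_step[of s \<tau>] st \<tau> by (intro mult_mono) auto
      finally show "norm (?g' \<tau>) \<le> \<bar>t\<bar> * (K * \<bar>s\<bar>)" .
    qed
    moreover have "\<bar>t\<bar> * (K * \<bar>s\<bar>) * \<bar>t - 0\<bar> = K * t\<^sup>2 * \<bar>s\<bar>"
      by (simp add: power2_eq_square ac_simps)
    moreover have "a + s *\<^sub>R ?e1 + t *\<^sub>R ?e2 = a + t *\<^sub>R ?e2 + s *\<^sub>R ?e1"
      by (simp add: ac_simps)
    ultimately show ?thesis by (simp only: scaleR_zero_left add_0_right)
  qed
  have "norm (pd_u F (a + t *\<^sub>R ?e2) - pd_u F a) \<le> K * t\<^sup>2" if t: "\<bar>t\<bar> \<le> r/2" for t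
  proof (rule norm_derivative_le_increment)
    let ?g = "\<lambda>s. F (a + t *\<^sub>R ?e2 + s *\<^sub>R ?e1) - F (a + s *\<^sub>R ?e1)"
    have "a + t *\<^sub>R ?e2 \<in> V" using box[of 0 t] t r by auto
    then show "(?g has_vector_derivative pd_u F (a + t *\<^sub>R ?e2) - pd_u F a) (at 0)"
      using has_vector_derivative_along_line[of F "a + t *\<^sub>R ?e2" 0 ?e1]
        has_vector_derivative_along_line[of F a 0 ?e1] F a(1)
      unfolding pd_u_def by (intro has_vector_derivative_diff) auto
    have "\<forall>\<^sub>F s in at 0. \<bar>s\<bar> \<le> r/2"
      using r(1) by (auto simp: eventually_at intro!: exI[of _ "r/2"])
    then show "\<forall>\<^sub>F s in at 0. norm (?g s - ?g 0) \<le> K * t\<^sup>2 * \<bar>s - 0\<bar>"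
    proof eventually_elim
      case (elim s)
      from F_step[OF this t] show ?case by (simp add: algebra_simps)
    qed
  qed
  then show ?thesis using that[of K "r/2"] K0 r(1) by auto
qed

text \<open>On the \<open>v\<close>-line through \<open>a\<close>, \<open>\<langle>F\<^sub>u(a), n\<rangle> = \<langle>F\<^sub>u(a) - F\<^sub>u, n\<rangle>\<close> is quadratically small, so its derivative
  at \<open>a\<close> vanishes.\<close>

lemma pd_u_orthogonal_pd_v_normal:
  fixes F n h :: "real^2 \<Rightarrow> real^3"
  assumes V: "open V" and h: "v_factor V F h"
    and F: "\<And>x. x \<in> V \<Longrightarrow> F differentiable (at x)"
    and n: "n differentiable (at a)" "\<And>x. x \<in> V \<Longrightarrow> norm (n x) = 1"
    and Fn: "\<And>x. x \<in> V \<Longrightarrow> pd_u F x \<bullet> n x = 0"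
    and a: "a \<in> V" "a$2 = 0"
  shows "pd_u F a \<bullet> pd_v n a = 0"
proof -
  define c where "c = (\<lambda>t. a + t *\<^sub>R (axis 2 1 :: real^2))"
  have c0: "c 0 = a" by (simp add: c_def)
  obtain K \<delta> where K: "K \<ge> 0" "\<delta> > 0"
    "\<And>t. \<bar>t\<bar> \<le> \<delta> \<Longrightarrow> norm (pd_u F (c t) - pd_u F a) \<le> K * t\<^sup>2"
    using pd_u_increment_quadratic[OF V h F a] unfolding c_def by blast
  have "((\<lambda>t. n (c t)) has_vector_derivative pd_v n a) (at 0)"
    using has_vector_derivative_along_line[of n a 0 "axis 2 1"] n(1)
    by (simp add: c_def pd_v_def)
  from bounded_linear.has_vector_derivative[OF bounded_linear_inner_right this]
  have d: "((\<lambda>t. pd_u F a \<bullet> n (c t)) has_vector_derivative pd_u F a \<bullet> pd_v n a) (at 0)" .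
  have "norm (pd_u F a \<bullet> pd_v n a) \<le> \<epsilon>" if \<epsilon>: "\<epsilon> > 0" for \<epsilon>
  proof (rule norm_derivative_le_increment[OF d])
    have "isCont c 0" unfolding c_def by (intro continuous_intros)
    then have "\<forall>\<^sub>F t in at 0. c t \<in> V"
      using V a by (intro topological_tendstoD) (auto simp: isCont_def c0)
    moreover have "\<forall>\<^sub>F t in at 0. \<bar>t\<bar> < min \<delta> (\<epsilon> / (K + 1))"
      using K \<epsilon> by (auto simp: eventually_at intro!: exI[of _ "min \<delta> (\<epsilon> / (K + 1))"])
    ultimately show "\<forall>\<^sub>F t in at 0. norm (pd_u F a \<bullet> n (c t) - pd_u F a \<bullet> n (c 0)) \<le> \<epsilon> * \<bar>t - 0\<bar>"
    proof eventually_elim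
      case (elim t)
      have "pd_u F a \<bullet> n (c t) = - ((pd_u F (c t) - pd_u F a) \<bullet> n (c t))"
        using Fn[OF elim(1)] by (simp add: inner_diff_left)
      then have "\<bar>pd_u F a \<bullet> n (c t)\<bar> \<le> norm (pd_u F (c t) - pd_u F a)"
        using Cauchy_Schwarz_ineq2[of "pd_u F (c t) - pd_u F a" "n (c t)"] n(2)[OF elim(1)] by simp
      also have "\<dots> \<le> (K * \<bar>t\<bar>) * \<bar>t\<bar>"
        using K(3)[of t] elim(2) by (simp add: power2_eq_square mult.assoc)
      also have "\<dots> \<le> \<epsilon> * \<bar>t\<bar>"
      proof (rule mult_right_mono)
        have "K * \<bar>t\<bar> \<le> (K + 1) * \<bar>t\<bar>" by (simp add: distrib_right)
        also have "\<dots> \<le> \<epsilon>" using elim(2) K(1) by (simp add: field_simps)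
        finally show "K * \<bar>t\<bar> \<le> \<epsilon>" .
      qed simp
      finally show ?case using Fn[OF a(1)] by (simp add: c0)
    qed
  qed
  then show ?thesis
    by (metis dense_ge norm_le_zero_iff)
qed

lemma inner_derivative_of_constant_inner:
  fixes g k :: "'a::real_normed_vector \<Rightarrow> 'b::real_inner"
  assumes V: "open V" "a \<in> V" and gk: "\<And>x. x \<in> V \<Longrightarrow> g x \<bullet> k x = c"
    and "g differentiable (at a)" "k differentiable (at a)"
  shows "g a \<bullet> frechet_derivative k (at a) w = - (frechet_derivative g (at a) w \<bullet> k a)"
proof -
  have "((\<lambda>x. g x \<bullet> k x) has_derivative
      (\<lambda>w. g a \<bullet> frechet_derivative k (at a) w + frechet_derivative g (at a) w \<bullet> k a)) (at a)"
    using assms by (intro has_derivative_inner has_frechet_derivative)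
  moreover have "((\<lambda>x. g x \<bullet> k x) has_derivative (\<lambda>w. 0)) (at a)"
    using has_derivative_const[of c] V
    by (rule has_derivative_transform_within_open) (simp add: gk)
  ultimately have "(\<lambda>w. g a \<bullet> frechet_derivative k (at a) w + frechet_derivative g (at a) w \<bullet> k a) = (\<lambda>w. 0)"
    by (rule has_derivative_unique)
  then show ?thesis by (metis add_eq_0_iff2)
qed

text \<open>The first-order part of being a unit normal field, relative to a parametrisation \<open>F\<close>.  It is shared by
  the given normal and the one supplied by the front, which are compared below.\<close>

definition unit_normal_along ::
  "(real^2) set \<Rightarrow> (real^2 \<Rightarrow> real^3) \<Rightarrow> (real^2 \<Rightarrow> real^3) \<Rightarrow> bool" where
  "unit_normal_along V F n \<longleftrightarrow> (\<forall>x\<in>V. n differentiable (at x) \<and> norm (n x) = 1 \<and>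
     pd_u F x \<bullet> n x = 0 \<and> pd_v F x \<bullet> n x = 0)"

lemma unit_normal_along_v_factor:
  assumes "open V" "v_factor V F h" "unit_normal_along V F n" "a \<in> V"
  shows "h a \<bullet> n a = 0"
  using assms unfolding unit_normal_along_def
  by (intro v_factor_orthogonal_normal[of V F h n])
    (auto intro!: continuous_at_imp_continuous_on differentiable_imp_continuous_within)

text \<open>The hypothesis on \<open>n'\<^sub>v\<close> is what an immersion \<open>(F, n')\<close> provides where \<open>F\<^sub>v = 0\<close>.  Differentiating \<open>\<langle>h, n\<rangle> = 0\<close>
  turns \<open>\<langle>h, n\<^sub>v\<rangle>\<close> into \<open>- \<langle>h\<^sub>v, n\<rangle>\<close>, which involves \<open>n\<close> at \<open>a\<close> only.  There \<open>n = \<plusminus> n'\<close>, so it suffices to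
  treat \<open>n'\<close>, and no coherent choice of sign near \<open>a\<close> is required.\<close>

lemma v_factor_pd_v_normal_nonzero:
  fixes F n n' h :: "real^2 \<Rightarrow> real^3"
  assumes V: "open V" and h: "v_factor V F h"
    and F: "\<And>x. x \<in> V \<Longrightarrow> F differentiable (at x)"
    and n: "unit_normal_along V F n" and n': "unit_normal_along V F n'"
    and a: "a \<in> V" "a$2 = 0"
    and ind: "pd_u F a \<times> h a \<noteq> 0" and imm: "pd_v n' a \<noteq> 0"
  shows "h a \<bullet> pd_v n a \<noteq> 0"
proof -
  have ortho: "h x \<bullet> n x = 0" "h x \<bullet> n' x = 0" if "x \<in> V" for x
    using unit_normal_along_v_factor[OF V h _ that] n n' by auto
  have hd: "h differentiable (at a)"
    using h a smooth_on_differentiable unfolding v_factor_def by blast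
  have nd: "n differentiable (at a)" "n' differentiable (at a)"
    using n n' a by (auto simp: unit_normal_along_def)
  have swap: "h a \<bullet> pd_v n a = - (pd_v h a \<bullet> n a)" "h a \<bullet> pd_v n' a = - (pd_v h a \<bullet> n' a)"
    unfolding pd_v_def
    using inner_derivative_of_constant_inner[OF V a(1) ortho(1) hd nd(1)]
      inner_derivative_of_constant_inner[OF V a(1) ortho(2) hd nd(2)] by blast+
  \<comment> \<open>otherwise \<open>n'\<^sub>v\<close> is orthogonal to the basis \<open>F\<^sub>u\<close>, \<open>h\<close>, \<open>n'\<close>\<close>
  have "h a \<bullet> pd_v n' a \<noteq> 0"
  proof
    assume "h a \<bullet> pd_v n' a = 0"
    moreover have "pd_u F a \<bullet> pd_v n' a = 0"
      using n' by (intro pd_u_orthogonal_pd_v_normal[OF V h F nd(2) _ _ a])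
        (auto simp: unit_normal_along_def)
    moreover have "n' a \<bullet> pd_v n' a = 0"
    proof -
      have "n' x \<bullet> n' x = 1" if "x \<in> V" for x
        using n' that by (simp add: unit_normal_along_def dot_square_norm)
      from inner_derivative_of_constant_inner[OF V a(1) this nd(2) nd(2), of "axis 2 1"]
      show ?thesis by (simp add: pd_v_def inner_commute)
    qed
    ultimately have "pd_v n' a = 0"
      using n' a(1) ortho(2)[OF a(1)] ind
      by (intro orthogonal_frame_imp_zero[of _ "pd_u F a" "h a" "n' a"])
        (auto simp: unit_normal_along_def inner_commute)
    with imm show False by simp
  qed
  moreover have "n a = n' a \<or> n a = - n' a"
    using n n' a(1) ortho[OF a(1)] ind
    by (intro unit_normal_unique_up_to_sign[of _ "pd_u F a" "h a"])
      (auto simp: unit_normal_along_def inner_commute)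
  ultimately show ?thesis unfolding swap by auto
qed

section \<open>The unbounded principal curvature and the area density\<close>

text \<open>For \<open>v = 0\<close> the radicand is the square of \<open>A = E N\<close>, and \<open>\<epsilon> = sgn N\<close> together with \<open>E \<ge> 0\<close> makes the two
  summands of the numerator equal instead of opposite.\<close>

lemma kappa_hat_origin:
  "kappa_hat F n h 0 = tE F 0 * tN n h 0 / norm (pd_u F 0 \<times> h 0)"
proof -
  have "sgn (tN n h 0) * \<bar>tE F 0 * tN n h 0\<bar> = tE F 0 * tN n h 0"
    by (simp add: abs_mult tE_def sgn_mult_abs mult.left_commute flip: mult.assoc)
  then show ?thesis by (simp add: kappa_hat_def tA_def tB_def)
qed

lemma isCont_kappa_hat:
  assumes "isCont (pd_u F) x" "isCont (pd_u n) x" "isCont (pd_v n) x" "isCont h x"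
    and "pd_u F x \<times> h x \<noteq> 0"
  shows "isCont (kappa_hat F n h) x"
  unfolding kappa_hat_def[abs_def] tA_def tB_def tE_def tF_def tG_def tL_def tM_def tN_def
  using assms by (intro continuous_intros continuous_cross) auto

lemma area_density_v_factor:
  assumes "v_factor V F h" "x \<in> V"
  shows "area_density F n x = x$2 * (pd_u F x \<bullet> (h x \<times> n x))"
  using assms by (simp add: v_factor_def area_density_def cross_mult_left flip: dot_cross_det)

text \<open>On the axis the \<open>v\<close>-derivative of \<open>v \<langle>F\<^sub>u, h \<times> n\<rangle>\<close> is the second factor, by its mere continuity.\<close>

lemma pd_v_area_density:
  fixes F n h :: "real^2 \<Rightarrow> real^3"
  assumes V: "open V" and h: "v_factor V F h" and a: "a \<in> V" "a$2 = 0"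
    and F: "isCont (pd_u F) a" and n: "isCont n a"
  shows "pd_v (area_density F n) a = pd_u F a \<bullet> (h a \<times> n a)"
proof -
  have "continuous_on V h"
    using h by (simp add: v_factor_def smooth_on_continuous)
  then have "isCont h a"
    using V a by (simp add: continuous_on_eq_continuous_at)
  then have "isCont (\<lambda>x. pd_u F x \<bullet> (h x \<times> n x)) a"
    by (intro continuous_inner continuous_cross F n)
  from has_derivative_scaleR_vanishing[OF
      bounded_linear_imp_has_derivative[OF bounded_linear_vec_nth[of 2]] a(2) this]
  have "((\<lambda>x. x$2 *\<^sub>R (pd_u F x \<bullet> (h x \<times> n x))) has_derivative
      (\<lambda>k. k$2 *\<^sub>R (pd_u F a \<bullet> (h a \<times> n a)))) (at a)" .
  then have "(area_density F n has_derivative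
      (\<lambda>k. k$2 *\<^sub>R (pd_u F a \<bullet> (h a \<times> n a)))) (at a)"
    using V a(1) by (rule has_derivative_transform_within_open) (simp add: area_density_v_factor[OF h])
  from frechet_derivative_at[OF this, symmetric] show ?thesis
    by (simp add: pd_v_def axis_def)
qed

section \<open>Change of coordinates\<close>

lemma smooth_diffeo_derivative_inverse:
  assumes \<phi>: "smooth_diffeo V U \<phi>" and a: "a \<in> V"
  shows "frechet_derivative (the_inv_into V \<phi>) (at (\<phi> a)) (frechet_derivative \<phi> (at a) k) = k"
    and "frechet_derivative \<phi> (at a) (frechet_derivative (the_inv_into V \<phi>) (at (\<phi> a)) X) = X"
proof -
  let ?\<psi> = "the_inv_into V \<phi>"
  have op: "open V" "open U" and bij: "bij_betw \<phi> V U"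
    using \<phi> by (auto simp: smooth_diffeo_def)
  have pU: "\<phi> a \<in> U" and inv: "\<And>x. x \<in> V \<Longrightarrow> ?\<psi> (\<phi> x) = x" "\<And>q. q \<in> U \<Longrightarrow> \<phi> (?\<psi> q) = q"
    using bij a by (auto simp: bij_betw_def the_inv_into_f_f f_the_inv_into_f)
  have d: "(\<phi> has_derivative frechet_derivative \<phi> (at a)) (at a)"
    "(?\<psi> has_derivative frechet_derivative ?\<psi> (at (\<phi> a))) (at (\<phi> a))"
    using \<phi> a pU by (auto simp: smooth_diffeo_def intro!: has_frechet_derivative smooth_on_differentiable)
  have "((?\<psi> \<circ> \<phi>) has_derivative (\<lambda>k. k)) (at a)"
    using has_derivative_ident op(1) a
    by (rule has_derivative_transform_within_open) (simp add: inv)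
  with diff_chain_at[OF d] have "frechet_derivative ?\<psi> (at (\<phi> a)) \<circ> frechet_derivative \<phi> (at a) = (\<lambda>k. k)"
    by (rule has_derivative_unique)
  then show "frechet_derivative ?\<psi> (at (\<phi> a)) (frechet_derivative \<phi> (at a) k) = k"
    by (metis comp_apply)
  have "((\<phi> \<circ> ?\<psi>) has_derivative (\<lambda>k. k)) (at (\<phi> a))"
    using has_derivative_ident op(2) pU
    by (rule has_derivative_transform_within_open) (simp add: inv)
  moreover have "((\<phi> \<circ> ?\<psi>) has_derivative
      frechet_derivative \<phi> (at a) \<circ> frechet_derivative ?\<psi> (at (\<phi> a))) (at (\<phi> a))"
    using d inv(1)[OF a] by (intro diff_chain_at) auto
  ultimately have "frechet_derivative \<phi> (at a) \<circ> frechet_derivative ?\<psi> (at (\<phi> a)) = (\<lambda>k. k)"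
    using has_derivative_unique by blast
  then show "frechet_derivative \<phi> (at a) (frechet_derivative ?\<psi> (at (\<phi> a)) X) = X"
    by (metis comp_apply)
qed

lemma unit_normal_along_parametrisation:
  assumes f: "smooth_on \<Sigma> f" and \<nu>: "unit_normal_field \<Sigma> f \<nu>"
    and \<phi>: "smooth_on V \<phi>" "\<phi> ` V \<subseteq> \<Sigma>"
  shows "unit_normal_along V (f \<circ> \<phi>) (\<nu> \<circ> \<phi>)"
  unfolding unit_normal_along_def
proof
  fix x assume x: "x \<in> V"
  then have d: "\<phi> differentiable (at x)" "f differentiable (at (\<phi> x))" "\<nu> differentiable (at (\<phi> x))"
    using f \<nu> \<phi> smooth_on_differentiable by (auto simp: unit_normal_field_def)
  have "(\<nu> \<circ> \<phi>) differentiable (at x)"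
    using d by (intro differentiable_chain_at)
  then show "(\<nu> \<circ> \<phi>) differentiable (at x) \<and> norm ((\<nu> \<circ> \<phi>) x) = 1 \<and>
      pd_u (f \<circ> \<phi>) x \<bullet> (\<nu> \<circ> \<phi>) x = 0 \<and> pd_v (f \<circ> \<phi>) x \<bullet> (\<nu> \<circ> \<phi>) x = 0"
    using \<nu> \<phi> x d by (auto simp: unit_normal_field_def pd_u_def pd_v_def frechet_derivative_compose)
qed

text \<open>The coordinate direction \<open>v\<close> is killed by the derivative of \<open>f\<close>, so an immersion \<open>(f, n)\<close> must detect
  it through \<open>n\<close>.\<close>

lemma pd_v_normal_nonzero:
  fixes f n :: "real^2 \<Rightarrow> real^3"
  assumes \<phi>: "smooth_diffeo V U \<phi>" and a: "a \<in> V"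
    and d: "f differentiable (at (\<phi> a))" "n differentiable (at (\<phi> a))"
    and fv: "pd_v (f \<circ> \<phi>) a = 0" and imm: "immersion_at (\<lambda>x. (f x, n x)) (\<phi> a)"
  shows "pd_v (n \<circ> \<phi>) a \<noteq> 0"
proof
  assume nv: "pd_v (n \<circ> \<phi>) a = 0"
  let ?D = "frechet_derivative \<phi> (at a)"
  let ?P = "frechet_derivative (\<lambda>x. (f x, n x)) (at (\<phi> a))"
  have d\<phi>: "\<phi> differentiable (at a)"
    using \<phi> a by (auto simp: smooth_diffeo_def intro: smooth_on_differentiable)
  have "((\<lambda>x. (f x, n x)) has_derivative
      (\<lambda>X. (frechet_derivative f (at (\<phi> a)) X, frechet_derivative n (at (\<phi> a)) X))) (at (\<phi> a))"
    by (intro has_derivative_Pair has_frechet_derivative d)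
  from frechet_derivative_at[OF this, symmetric]
  have "?P (?D (axis 2 1)) = 0"
    using fv nv by (simp add: pd_v_def frechet_derivative_compose d d\<phi> zero_prod_def)
  moreover have "linear ?P"
    using imm by (intro linear_frechet_derivative) (simp add: immersion_at_def)
  ultimately have "?D (axis 2 1) = 0"
    using imm by (auto simp: immersion_at_def linear_injective_0)
  also have "0 = ?D 0"
    using linear_0[OF linear_frechet_derivative[OF d\<phi>]] by simp
  finally have "axis 2 1 = (0 :: real^2)"
    using smooth_diffeo_derivative_inverse(1)[OF \<phi> a] by metis
  then show False by (simp add: axis_eq_0_iff)
qed

section \<open>The focal surface\<close>

text \<open>The offset \<open>(\<lambda> / \<kappa>) \<nu>\<close> is the coordinate \<open>v\<close> times a field that is continuous at \<open>p\<close>, and \<open>v\<close> vanishes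
  at \<open>p\<close>; so it contributes \<open>k\<^sub>2\<close> times the value of the field.  The derivative of \<open>f\<close> contributes
  \<open>k\<^sub>1 F\<^sub>u\<close> only, as \<open>F\<^sub>v = 0\<close> at the origin.\<close>

lemma focal_surface_has_derivative:
  assumes f: "smooth_on \<Sigma> f" and \<nu>: "unit_normal_field \<Sigma> f \<nu>"
    and \<phi>: "smooth_diffeo V U \<phi>" "U \<subseteq> \<Sigma>"
    and h: "v_factor V (f \<circ> \<phi>) h"
    and a: "0 \<in> V" "\<phi> 0 = p"
    and ind: "pd_u (f \<circ> \<phi>) 0 \<times> h 0 \<noteq> 0" and N: "tN (\<nu> \<circ> \<phi>) h 0 \<noteq> 0"
  defines "c \<equiv> (pd_u (f \<circ> \<phi>) 0 \<bullet> (h 0 \<times> \<nu> p)) / kappa_hat (f \<circ> \<phi>) (\<nu> \<circ> \<phi>) h 0"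
  shows "(focal_surface f \<nu> V \<phi> h has_derivative
           (\<lambda>X. let k = frechet_derivative (the_inv_into V \<phi>) (at p) X in
              k$1 *\<^sub>R pd_u (f \<circ> \<phi>) 0 + k$2 *\<^sub>R (c *\<^sub>R \<nu> p))) (at p)"
proof -
  let ?F = "f \<circ> \<phi>" and ?n = "\<nu> \<circ> \<phi>" and ?\<psi> = "the_inv_into V \<phi>"
  let ?D\<psi> = "frechet_derivative ?\<psi> (at p)"
  have op: "open V" "open U" and bij: "bij_betw \<phi> V U"
    and sm: "smooth_on V \<phi>" "smooth_on U ?\<psi>"
    using \<phi> by (auto simp: smooth_diffeo_def)
  have img: "\<phi> ` V \<subseteq> \<Sigma>" and pU: "p \<in> U" and \<psi>p: "?\<psi> p = 0" and \<psi>V: "\<And>q. q \<in> U \<Longrightarrow> ?\<psi> q \<in> V"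
    using bij \<phi>(2) a by (auto simp: bij_betw_def the_inv_into_f_f the_inv_into_into)
  have sn: "smooth_on \<Sigma> \<nu>" using \<nu> by (simp add: unit_normal_field_def)
  have d\<psi>: "(?\<psi> has_derivative ?D\<psi>) (at p)"
    by (intro has_frechet_derivative smooth_on_differentiable[OF sm(2) pU])
  have df: "(f has_derivative frechet_derivative f (at p)) (at p)"
    using pU \<phi>(2) by (intro has_frechet_derivative smooth_on_differentiable[OF f]) auto
  have cont: "isCont (pd_u ?F) 0" "isCont (pd_u ?n) 0" "isCont (pd_v ?n) 0" "isCont h 0"
    "isCont ?n 0" "isCont ?\<psi> p" "isCont \<nu> p"
  proof -
    have "continuous_on V (pd_u ?F)" "continuous_on V (pd_u ?n)" "continuous_on V (pd_v ?n)"
      using continuous_on_derivative_compose[OF f sm(1) img]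
        continuous_on_derivative_compose[OF sn sm(1) img]
      by (simp_all add: pd_u_def[abs_def] pd_v_def[abs_def])
    moreover have "continuous_on V h"
      using h by (simp add: v_factor_def smooth_on_continuous)
    ultimately show "isCont (pd_u ?F) 0" "isCont (pd_u ?n) 0" "isCont (pd_v ?n) 0" "isCont h 0"
      using op(1) a(1) by (auto simp: continuous_on_eq_continuous_at)
    show "isCont ?\<psi> p" by (rule has_derivative_continuous[OF d\<psi>])
    show \<nu>p: "isCont \<nu> p"
      using pU \<phi>(2) by (intro differentiable_imp_continuous_within smooth_on_differentiable[OF sn]) auto
    have "isCont \<phi> 0"
      by (intro differentiable_imp_continuous_within smooth_on_differentiable[OF sm(1) a(1)])
    then show "isCont ?n 0" using \<nu>p a(2) by (auto intro: continuous_at_compose)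
  qed
  define w where "w = (\<lambda>x. (pd_u ?F x \<bullet> (h x \<times> ?n x)) / kappa_hat ?F ?n h x)"
  have "kappa_hat ?F ?n h 0 \<noteq> 0"
    using ind N by (auto simp: kappa_hat_origin tE_def)
  then have "isCont w (?\<psi> p)"
    unfolding w_def \<psi>p
    by (intro continuous_at_within_divide continuous_inner continuous_cross
        isCont_kappa_hat cont ind)
  with cont(6) have "isCont (\<lambda>q. w (?\<psi> q)) p"
    by (rule isCont_o2)
  then have m: "isCont (\<lambda>q. w (?\<psi> q) *\<^sub>R \<nu> q) p"
    using cont(7) by (intro continuous_intros)
  have "((\<lambda>q. ?\<psi> q $ 2) has_derivative (\<lambda>X. ?D\<psi> X $ 2)) (at p)"
    by (rule bounded_linear.has_derivative[OF bounded_linear_vec_nth d\<psi>])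
  from has_derivative_add[OF df has_derivative_scaleR_vanishing[OF this _ m]] \<psi>p
  have "((\<lambda>q. f q + (?\<psi> q $ 2) *\<^sub>R (w (?\<psi> q) *\<^sub>R \<nu> q)) has_derivative
      (\<lambda>X. frechet_derivative f (at p) X + (?D\<psi> X $ 2) *\<^sub>R (w (?\<psi> p) *\<^sub>R \<nu> p))) (at p)"
    by simp
  moreover have "frechet_derivative f (at p) X = (?D\<psi> X $ 1) *\<^sub>R pd_u ?F 0" for X
  proof -
    let ?k = "?D\<psi> X"
    have d\<phi>: "\<phi> differentiable (at 0)" "f differentiable (at (\<phi> 0))"
      using smooth_on_differentiable[OF sm(1) a(1)] df a(2) by (auto simp: differentiable_def)
    have "frechet_derivative f (at p) X = frechet_derivative f (at p) (frechet_derivative \<phi> (at 0) ?k)"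
      using smooth_diffeo_derivative_inverse(2)[OF \<phi>(1) a(1)] a(2) by simp
    also have "\<dots> = frechet_derivative ?F (at 0) ?k"
      by (simp add: frechet_derivative_compose[OF d\<phi>] a(2))
    also have "\<dots> = ?k$1 *\<^sub>R pd_u ?F 0 + ?k$2 *\<^sub>R pd_v ?F 0"
      unfolding pd_u_def pd_v_def
      by (intro linear_real2 linear_frechet_derivative differentiable_chain_at d\<phi>)
    also have "pd_v ?F 0 = 0"
      using h a(1) by (simp add: v_factor_def)
    finally show ?thesis by (simp only: scaleR_zero_right add_0_right)
  qed
  ultimately have "((\<lambda>q. f q + (?\<psi> q $ 2) *\<^sub>R (w (?\<psi> q) *\<^sub>R \<nu> q)) has_derivative
      (\<lambda>X. let k = ?D\<psi> X in k$1 *\<^sub>R pd_u ?F 0 + k$2 *\<^sub>R (c *\<^sub>R \<nu> p))) (at p)"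
    by (simp add: Let_def w_def c_def \<psi>p a(2))
  then show ?thesis
    using op(2) pU
  proof (rule has_derivative_transform_within_open)
    fix q assume "q \<in> U"
    then show "f q + (?\<psi> q $ 2) *\<^sub>R (w (?\<psi> q) *\<^sub>R \<nu> q) = focal_surface f \<nu> V \<phi> h q"
      using area_density_v_factor[OF h \<psi>V, of q ?n] by (simp add: focal_surface_def Let_def w_def)
  qed
qed

theorem proposition3p7:
  fixes \<Sigma> V U :: "(real^2) set"
    and f \<nu> h :: "real^2 \<Rightarrow> real^3"
    and \<phi> :: "real^2 \<Rightarrow> real^2"
    and p :: "real^2"
  assumes "open \<Sigma>" "connected \<Sigma>"
    and "front \<Sigma> f"
    and "unit_normal_field \<Sigma> f \<nu>"
    and "p \<in> \<Sigma>" "cuspidal_edge \<Sigma> f p"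
    and "adapted_coordinates \<Sigma> f \<nu> p V U \<phi>"
    and "v_factor V (f \<circ> \<phi>) h"
  shows "immersion_at (focal_surface f \<nu> V \<phi> h) p \<and>
         planes_intersect_orthogonally
           (limiting_tangent_plane f \<nu> p)
           (tangent_plane_at (focal_surface f \<nu> V \<phi> h) p)"
proof -
  let ?F = "f \<circ> \<phi>" and ?n = "\<nu> \<circ> \<phi>" and ?\<psi> = "the_inv_into V \<phi>"
  let ?g = "focal_surface f \<nu> V \<phi> h"
  let ?D\<psi> = "frechet_derivative ?\<psi> (at p)" and ?D\<phi> = "frechet_derivative \<phi> (at 0)"
  have \<phi>: "smooth_diffeo V U \<phi>" and V: "open V" "0 \<in> V" and p: "\<phi> 0 = p" and U: "U \<subseteq> \<Sigma>"
    and \<lambda>: "pd_v (area_density ?F ?n) 0 > 0"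
    using assms(7) by (auto simp: adapted_coordinates_def smooth_diffeo_def)
  have sm: "smooth_on V \<phi>" and img: "\<phi> ` V \<subseteq> \<Sigma>"
    using \<phi> U by (auto simp: smooth_diffeo_def bij_betw_def)
  have h: "v_factor V ?F h" and \<nu>: "unit_normal_field \<Sigma> f \<nu>" by fact+
  obtain \<nu>' where f: "smooth_on \<Sigma> f" and \<nu>': "unit_normal_field \<Sigma> f \<nu>'"
    and imm: "immersion_at (\<lambda>x. (f x, \<nu>' x)) p"
    using assms(3,5) by (auto simp: front_def)
  have n: "unit_normal_along V ?F ?n" "unit_normal_along V ?F (\<nu>' \<circ> \<phi>)"
    by (rule unit_normal_along_parametrisation[OF f \<nu> sm img]
        unit_normal_along_parametrisation[OF f \<nu>' sm img])+
  have d\<phi>: "\<phi> differentiable (at x)" "f differentiable (at (\<phi> x))" if "x \<in> V" for x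
    using that img smooth_on_differentiable[OF sm] smooth_on_differentiable[OF f] by auto
  have F: "?F differentiable (at x)" if "x \<in> V" for x
    using d\<phi>[OF that] by (rule differentiable_chain_at)
  have inverse: "?D\<psi> (?D\<phi> k) = k" "?D\<phi> (?D\<psi> X) = X" for k X
    using smooth_diffeo_derivative_inverse[OF \<phi> V(2)] p by simp_all

  have lin\<phi>: "linear ?D\<phi>"
    by (intro linear_frechet_derivative d\<phi> V)

  have "isCont (pd_u ?F) 0"
    using continuous_on_derivative_compose[OF f sm img, of "axis 1 1"] V
    by (simp add: pd_u_def[abs_def] continuous_on_eq_continuous_at)
  moreover have "isCont ?n 0"
    using n(1) V by (auto simp only: unit_normal_along_def intro!: differentiable_imp_continuous_within)
  ultimately have "pd_v (area_density ?F ?n) 0 = pd_u ?F 0 \<bullet> (h 0 \<times> ?n 0)"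
    using V by (intro pd_v_area_density[OF _ h]) simp_all
  with \<lambda> have triple: "pd_u ?F 0 \<bullet> (h 0 \<times> \<nu> p) > 0"
    by (simp add: p)
  have ind: "pd_u ?F 0 \<times> h 0 \<noteq> 0"
  proof
    assume "pd_u ?F 0 \<times> h 0 = 0"
    moreover have "pd_u ?F 0 \<bullet> (h 0 \<times> \<nu> p) = (pd_u ?F 0 \<times> h 0) \<bullet> \<nu> p"
      by (simp add: cross3_simps)
    ultimately show False using triple by simp
  qed

  have "pd_v (\<nu>' \<circ> \<phi>) 0 \<noteq> 0"
  proof (rule pd_v_normal_nonzero[OF \<phi> V(2)])
    show "f differentiable (at (\<phi> 0))" by (rule d\<phi>(2)[OF V(2)])
    show "\<nu>' differentiable (at (\<phi> 0))"
      using \<nu>' assms(5) p by (auto simp: unit_normal_field_def intro: smooth_on_differentiable)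
    show "pd_v ?F 0 = 0" using h V(2) by (simp add: v_factor_def)
    show "immersion_at (\<lambda>x. (f x, \<nu>' x)) (\<phi> 0)" using imm p by simp
  qed
  then have N: "tN ?n h 0 \<noteq> 0"
    using v_factor_pd_v_normal_nonzero[OF V(1) h F n V(2) _ ind] by (simp add: tN_def)

  define c where "c = (pd_u ?F 0 \<bullet> (h 0 \<times> \<nu> p)) / kappa_hat ?F ?n h 0"
  define x where "x = pd_u ?F 0"
  define z where "z = \<nu> p"
  have c: "c \<noteq> 0"
    using triple ind N by (auto simp: c_def kappa_hat_origin tE_def)
  have xz: "x \<bullet> z = 0" "x \<noteq> 0" "z \<noteq> 0"
    using n(1) V(2) ind by (auto simp: x_def z_def unit_normal_along_def p)
  have gD: "(?g has_derivative (\<lambda>X. let k = ?D\<psi> X in k$1 *\<^sub>R x + k$2 *\<^sub>R (c *\<^sub>R z))) (at p)"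
    unfolding x_def z_def c_def
    by (rule focal_surface_has_derivative[OF f \<nu> \<phi> U h V(2) p ind N])
  have Dg: "frechet_derivative ?g (at p) X = (?D\<psi> X)$1 *\<^sub>R x + (?D\<psi> X)$2 *\<^sub>R (c *\<^sub>R z)" for X
    by (simp add: frechet_derivative_at[OF gD, symmetric] Let_def)

  have "inj (frechet_derivative ?g (at p))"
  proof -
    have gd: "?g differentiable (at p)" using gD by (auto simp: differentiable_def)
    have "X = 0" if "frechet_derivative ?g (at p) X = 0" for X
    proof -
      let ?Y = "(?D\<psi> X)$1 *\<^sub>R x + (?D\<psi> X)$2 *\<^sub>R (c *\<^sub>R z)"
      have Y: "?Y = 0" using that by (simp only: Dg)
      have "(?D\<psi> X)$1 * (x \<bullet> x) = ?Y \<bullet> x" "(?D\<psi> X)$2 * c * (z \<bullet> z) = ?Y \<bullet> z"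
        using xz(1) by (simp_all add: inner_add_left inner_commute[of z x])
      then have "(?D\<psi> X)$1 * (x \<bullet> x) = 0" "(?D\<psi> X)$2 * c * (z \<bullet> z) = 0"
        by (simp_all only: Y inner_zero_left)
      then have "(?D\<psi> X)$1 = 0" "(?D\<psi> X)$2 = 0" using xz c by simp_all
      then have "?D\<psi> X = 0" by (simp add: vec_eq_iff forall_2)
      then show ?thesis using inverse(2)[of X] linear_0[OF lin\<phi>] by simp
    qed
    then show ?thesis using linear_injective_0[OF linear_frechet_derivative[OF gd]] by blast
  qed
  then have immersion: "immersion_at ?g p"
    using gD by (auto simp: immersion_at_def differentiable_def)

  have gp: "?g p = f p"
  proof -
    have "?\<psi> p = 0" using \<phi> V(2) p by (auto simp: smooth_diffeo_def bij_betw_def the_inv_into_f_f)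
    then show ?thesis
      by (simp add: focal_surface_def area_density_v_factor[OF h V(2)])
  qed
  have "tangent_plane_at ?g p = range (\<lambda>(r, s). f p + (r *\<^sub>R x + s *\<^sub>R z))"
  proof (intro equalityI subsetI)
    fix y assume "y \<in> tangent_plane_at ?g p"
    then show "y \<in> range (\<lambda>(r, s). f p + (r *\<^sub>R x + s *\<^sub>R z))"
      by (auto simp: tangent_plane_at_def gp Dg image_iff)
  next
    fix y assume "y \<in> range (\<lambda>(r, s). f p + (r *\<^sub>R x + s *\<^sub>R z))"
    then obtain r s where y: "y = f p + (r *\<^sub>R x + s *\<^sub>R z)" by auto
    \<comment> \<open>the coefficient of \<open>z\<close> in the derivative is \<open>k\<^sub>2 c\<close>\<close>
    have "y = f p + frechet_derivative ?g (at p) (?D\<phi> (vector [r, s / c]))"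
      using c by (simp add: y Dg inverse(1))
    then show "y \<in> tangent_plane_at ?g p" by (auto simp: tangent_plane_at_def gp)
  qed
  also have "\<dots> = {y. (y - f p) \<bullet> (x \<times> z) = 0}"
    by (rule plane_spanned_by_orthogonal[OF xz])
  finally have "planes_intersect_orthogonally (limiting_tangent_plane f \<nu> p) (tangent_plane_at ?g p)"
    unfolding planes_intersect_orthogonally_def limiting_tangent_plane_def z_def[symmetric]
    using xz(3) cross3_orthogonal_nonzero[OF xz]
    by (intro exI[of _ "f p"] exI[of _ z] exI[of _ "x \<times> z"])
      (simp add: orthogonal_def dot_cross_self)
  with immersion show ?thesis by blast
qed

end
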